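(* Any single-pass streaming algorithm that decides, with probability $2/3$, whether $\mathrm{OPT}>0$ for $\textup{Min-SAT}$ on $n$ variables must use $\Omega(n)$ bits of space.
   Context: $\textup{Min-SAT}$: given clauses over Boolean variables $x_1,\dots,x_n$, each clause a disjunction of literals, find an assignment minimizing the number of satisfied clauses. $\mathrm{OPT}$ is this minimum. The clauses arrive one at a time in a stream, and the algorithm makes a single pass. *)

theory Defs
  imports "HOL-Probability.Probability"
begin

datatype literal = Pos nat | Neg nat

type_synonym clause = "literal set"

definition clauses :: "nat \<Rightarrow> clause set" where
  "clauses n = Pow (Pos ` {1..n} \<union> Neg ` {1..n})"

text \<open>Assignments are total; only their values on the variables of the instance matter.\<close>

type_synonym assignment = "nat \<Rightarrow> bool"

fun lit_true :: "assignment \<Rightarrow> literal \<Rightarrow> bool" where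
  "lit_true a (Pos i) \<longleftrightarrow> a i"
| "lit_true a (Neg i) \<longleftrightarrow> \<not> a i"

definition satisfies :: "assignment \<Rightarrow> clause \<Rightarrow> bool" where
  "satisfies a C \<longleftrightarrow> (\<exists>l\<in>C. lit_true a l)"

text \<open>Clauses are counted with multiplicity.\<close>

definition num_satisfied :: "assignment \<Rightarrow> clause list \<Rightarrow> nat" where
  "num_satisfied a \<sigma> = length (filter (satisfies a) \<sigma>)"

text \<open>The set below is finite, since the counts are bounded by the length of the instance.\<close>

definition min_sat_opt :: "clause list \<Rightarrow> nat" where
  "min_sat_opt \<sigma> = Min (range (\<lambda>a. num_satisfied a \<sigma>))"

text \<open>
  The memory content between two stream items is a bit string. The algorithm has two sources of
  randomness, neither of which is charged to its space: a random seed of some type \<open>'r\<close>,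
  drawn once and readable at all times, and fresh coins in every step (the steps are probabilistic).
  There are no computational restrictions on the steps.
\<close>

record 'r streaming_alg =
  seed :: "'r pmf"
  initial :: "'r \<Rightarrow> bool list pmf"
  update :: "'r \<Rightarrow> clause \<Rightarrow> bool list \<Rightarrow> bool list pmf"
  answer :: "'r \<Rightarrow> bool list \<Rightarrow> bool pmf"

definition memory_after :: "'r streaming_alg \<Rightarrow> 'r \<Rightarrow> clause list \<Rightarrow> bool list pmf" where
  "memory_after A r \<sigma> = foldl (\<lambda>p C. bind_pmf p (update A r C)) (initial A r) \<sigma>"

definition result :: "'r streaming_alg \<Rightarrow> clause list \<Rightarrow> bool pmf" where
  "result A \<sigma> = bind_pmf (seed A) (\<lambda>r. bind_pmf (memory_after A r \<sigma>) (answer A r))"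

definition decides_opt_pos :: "nat \<Rightarrow> 'r streaming_alg \<Rightarrow> bool" where
  "decides_opt_pos n A \<longleftrightarrow>
     (\<forall>\<sigma>\<in>lists (clauses n).
        measure_pmf.prob (result A \<sigma>) {b. b \<longleftrightarrow> min_sat_opt \<sigma> > 0} \<ge> 2 / 3)"

text \<open>
  Worst-case number of bits of memory over all streams on \<open>n\<close> variables and all random choices.
  Prefixes of streams are streams, so this takes the memory at all intermediate times into account.
\<close>

definition space_used :: "nat \<Rightarrow> 'r streaming_alg \<Rightarrow> enat" where
  "space_used n A =
     (SUP \<sigma>\<in>lists (clauses n). SUP r\<in>set_pmf (seed A). SUP m\<in>set_pmf (memory_after A r \<sigma>).
        enat (length m))"

end

theory Submission
  imports Defs
begin

text \<open>
  Reduction from the one-way communication problem INDEX: on the two-clause stream consisting of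
  \<open>Pos ` X\<close> and \<open>{Neg i}\<close>, the optimum is positive iff \<open>i \<in> X\<close>. Fix a good seed by averaging. If
  \<open>Y\<^sub>X m\<close> denotes the expected number of indices answered correctly from memory content \<open>m\<close>, then
  the average over \<open>X\<close> of \<open>Y\<^sub>X\<close> is at least \<open>2n/3\<close>, so that \<open>2 powr Y\<^sub>X\<close> averages to at least
  \<open>2 powr (2n/3)\<close> by Jensen. For each fixed \<open>m\<close>, however, the sum of \<open>2 powr Y\<^sub>X m\<close> over all
  \<open>X\<close> factorises over the indices into terms \<open>2 powr p + 2 powr (1 - p) \<le> 3\<close>, hence there must
  be at least \<open>2 powr (5n/3) / 3 ^ n\<close> memory contents.
\<close>

text \<open>An assignment that falsifies \<open>{Neg i}\<close> makes \<open>i\<close> true, so for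
  \<open>i \<in> X\<close> it satisfies the first clause. For \<open>i \<notin> X\<close>, making
  \<open>i\<close> the only true variable falsifies both clauses.\<close>

lemma min_sat_opt_index:
  "min_sat_opt [Pos ` X, {Neg i}] > 0 \<longleftrightarrow> i \<in> X"
proof -
  let ?\<sigma> = "[Pos ` X, {Neg i}]"
  have fin: "finite (range (\<lambda>a. num_satisfied a ?\<sigma>))"
    by (rule finite_subset[of _ "{..2}"])
      (auto simp: num_satisfied_def intro: le_trans[OF length_filter_le])
  have "min_sat_opt ?\<sigma> > 0 \<longleftrightarrow> (\<forall>a. num_satisfied a ?\<sigma> > 0)"
    unfolding min_sat_opt_def by (subst Min_gr_iff[OF fin]) auto
  also have "\<dots> \<longleftrightarrow> (\<forall>a. (\<exists>j\<in>X. a j) \<or> \<not> a i)"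
    by (auto simp: num_satisfied_def satisfies_def)
  also have "\<dots> \<longleftrightarrow> i \<in> X"
    by (auto dest: spec[of _ "\<lambda>j. j = i"])
  finally show ?thesis .
qed

text \<open>By convexity the graph lies below its chord over [0, 1].\<close>

lemma two_powr_le:
  fixes q :: real
  assumes "0 \<le> q" "q \<le> 1"
  shows "2 powr q \<le> 1 + q"
proof -
  have "exp ((1 - q) *\<^sub>R 0 + q *\<^sub>R ln 2) \<le> (1 - q) * exp 0 + q * exp (ln 2 :: real)"
    by (rule convex_onD[OF exp_convex]) (use assms in auto)
  then show ?thesis
    by (simp add: powr_def)
qed

text \<open>By convexity the graph lies above its tangent at \<open>a\<close>. Jensen's inequality
  enters in this linear form, which can be averaged termwise.\<close>

lemma two_powr_tangent:
  fixes a y :: real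
  shows "2 powr a * (1 + ln 2 * (y - a)) \<le> 2 powr y"
proof -
  have "2 powr a * (1 + ln 2 * (y - a)) \<le> 2 powr a * exp (ln 2 * (y - a))"
    by (intro mult_left_mono exp_ge_add_one_self) auto
  also have "\<dots> = 2 powr y"
    by (simp add: powr_def flip: exp_add) (simp add: algebra_simps)
  finally show ?thesis .
qed

lemma pmf_True_add_False:
  fixes p :: "bool pmf"
  shows "pmf p True + pmf p False = 1"
proof -
  have "(\<Sum>b\<in>UNIV. pmf p b) = 1"
    by (rule sum_pmf_eq_1) auto
  then show ?thesis
    by (simp add: UNIV_bool add.commute)
qed

lemma ex_set_pmf_expectation_le:
  fixes f :: "'a \<Rightarrow> real"
  assumes "integrable (measure_pmf p) f" "c \<le> measure_pmf.expectation p f"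
  shows "\<exists>x\<in>set_pmf p. c \<le> f x"
proof (rule ccontr)
  assume "\<not> ?thesis"
  then have "\<forall>x\<in>set_pmf p. f x < c" by auto
  then have "measure_pmf.expectation p f < c"
    using assms(1) by (intro measure_pmf.expectation_less) (auto simp: AE_measure_pmf_iff)
  with assms(2) show False by simp
qed

text \<open>The power turns the sum over \<open>i\<close> into a product that splits along
  \<open>X\<close> and \<open>I - X\<close>; summing over \<open>X\<close> then expands a product of
  binomials. The chord bound limits each factor to (1 + p) + (1 + (1 - p)) = 3.\<close>

lemma sum_two_powr_index_le:
  fixes g :: "'a \<Rightarrow> bool pmf"
  assumes "finite I"
  shows "(\<Sum>X\<in>Pow I. 2 powr (\<Sum>i\<in>I. pmf (g i) (i \<in> X))) \<le> (3::real) ^ card I"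
proof -
  have "2 powr (\<Sum>i\<in>I. pmf (g i) (i \<in> X)) =
      (\<Prod>i\<in>X. 2 powr pmf (g i) True) * (\<Prod>i\<in>I - X. 2 powr pmf (g i) False)"
    if "X \<in> Pow I" for X
  proof -
    have "2 powr (\<Sum>i\<in>I. pmf (g i) (i \<in> X)) = (\<Prod>i\<in>I. 2 powr pmf (g i) (i \<in> X))"
      using assms by (simp add: powr_sum)
    also have "\<dots> = (\<Prod>i\<in>I - X. 2 powr pmf (g i) (i \<in> X)) * (\<Prod>i\<in>X. 2 powr pmf (g i) (i \<in> X))"
      using assms that by (intro prod.subset_diff) auto
    finally show ?thesis
      by (simp add: mult.commute)
  qed
  then have "(\<Sum>X\<in>Pow I. 2 powr (\<Sum>i\<in>I. pmf (g i) (i \<in> X))) =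
      (\<Prod>i\<in>I. 2 powr pmf (g i) True + 2 powr pmf (g i) False)"
    using assms by (simp add: prod_add)
  also have "\<dots> \<le> (\<Prod>i\<in>I. 3)"
  proof (intro prod_mono conjI)
    fix i
    show "2 powr pmf (g i) True + 2 powr pmf (g i) False \<le> (3::real)"
      using two_powr_le[of "pmf (g i) True"] two_powr_le[of "pmf (g i) False"]
        pmf_True_add_False[of "g i"] by (simp add: pmf_le_1)
  qed simp
  finally show ?thesis by simp
qed

text \<open>INDEX in abstract form: \<open>M X\<close> is the random message encoding
  \<open>X\<close>, \<open>g i\<close> the decoder queried at \<open>i\<close>, and \<open>q\<close>
  a lower bound on the success probability averaged over all pairs.\<close>

lemma index_lower_bound:
  fixes M :: "'a set \<Rightarrow> 'm pmf" and g :: "'a \<Rightarrow> 'm \<Rightarrow> bool pmf" and q :: real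
  assumes I: "finite I" and L: "finite L"
    and supp: "\<And>X. X \<subseteq> I \<Longrightarrow> set_pmf (M X) \<subseteq> L"
    and succ: "q * card I * 2 ^ card I \<le>
      (\<Sum>X\<in>Pow I. \<Sum>i\<in>I. pmf (bind_pmf (M X) (g i)) (i \<in> X))"
  shows "2 ^ card I * 2 powr (q * card I) \<le> card L * (3::real) ^ card I"
proof -
  define Y where "Y X m = (\<Sum>i\<in>I. pmf (g i m) (i \<in> X))" for X m
  define a where "a = q * card I"
  have weights: "(\<Sum>m\<in>L. pmf (M X) m) = 1" if "X \<subseteq> I" for X
    using sum_pmf_eq_1[OF L supp[OF that]] .
  have "(\<Sum>i\<in>I. pmf (bind_pmf (M X) (g i)) (i \<in> X)) = (\<Sum>m\<in>L. pmf (M X) m * Y X m)"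
    if "X \<subseteq> I" for X
  proof -
    have "pmf (bind_pmf (M X) (g i)) b = (\<Sum>m\<in>L. pmf (M X) m * pmf (g i m) b)" for i b
      unfolding pmf_bind using supp[OF that]
      by (subst integral_measure_pmf[OF L]) auto
    then show ?thesis
      unfolding Y_def by (simp add: sum_distrib_left) (rule sum.swap)
  qed
  then have succ': "a * 2 ^ card I \<le> (\<Sum>X\<in>Pow I. \<Sum>m\<in>L. pmf (M X) m * Y X m)"
    using succ unfolding a_def by simp
  \<comment> \<open>The added term is nonnegative by \<open>succ'\<close>. With it, the right-hand
    side is the weighted sum of the tangent at \<open>a\<close>, evaluated at all
    \<open>Y X m\<close>.\<close>
  have "2 ^ card I * 2 powr a \<le> 2 ^ card I * 2 powr a +
      2 powr a * ln 2 * ((\<Sum>X\<in>Pow I. \<Sum>m\<in>L. pmf (M X) m * Y X m) - a * 2 ^ card I)"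
    using succ' by simp
  also have "\<dots> = (\<Sum>X\<in>Pow I. 2 powr a +
      2 powr a * ln 2 * ((\<Sum>m\<in>L. pmf (M X) m * Y X m) - a))"
    using I by (simp add: sum.distrib sum_subtractf card_Pow algebra_simps flip: sum_distrib_left)
  also have "\<dots> = (\<Sum>X\<in>Pow I. \<Sum>m\<in>L. pmf (M X) m * (2 powr a * (1 + ln 2 * (Y X m - a))))"
  proof (intro sum.cong refl)
    fix X assume "X \<in> Pow I"
    then have w: "(\<Sum>m\<in>L. pmf (M X) m) = 1" using weights by simp
    have "(\<Sum>m\<in>L. pmf (M X) m * (2 powr a * (1 + ln 2 * (Y X m - a)))) =
        (\<Sum>m\<in>L. (2 powr a - 2 powr a * ln 2 * a) * pmf (M X) m +
          2 powr a * ln 2 * (pmf (M X) m * Y X m))"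
      by (intro sum.cong) (simp_all add: algebra_simps)
    also have "\<dots> = (2 powr a - 2 powr a * ln 2 * a) * (\<Sum>m\<in>L. pmf (M X) m) +
          2 powr a * ln 2 * (\<Sum>m\<in>L. pmf (M X) m * Y X m)"
      by (simp only: sum.distrib sum_distrib_left)
    finally show "2 powr a + 2 powr a * ln 2 * ((\<Sum>m\<in>L. pmf (M X) m * Y X m) - a) =
        (\<Sum>m\<in>L. pmf (M X) m * (2 powr a * (1 + ln 2 * (Y X m - a))))"
      by (simp add: w algebra_simps)
  qed
  also have "\<dots> \<le> (\<Sum>X\<in>Pow I. \<Sum>m\<in>L. 1 * 2 powr Y X m)"
  proof (intro sum_mono)
    fix X m
    have "pmf (M X) m * (2 powr a * (1 + ln 2 * (Y X m - a))) \<le> pmf (M X) m * 2 powr Y X m"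
      by (intro mult_left_mono two_powr_tangent) simp
    \<comment> \<open>Bounding the weight by 1 removes the dependence on \<open>M X\<close>, so that
      the sum over \<open>X\<close> can be taken for each fixed \<open>m\<close>. The price is the
      factor \<open>card L\<close>.\<close>
    also have "\<dots> \<le> 1 * 2 powr Y X m"
      by (intro mult_right_mono pmf_le_1) simp
    finally show "pmf (M X) m * (2 powr a * (1 + ln 2 * (Y X m - a))) \<le> 1 * 2 powr Y X m" .
  qed
  also have "\<dots> = (\<Sum>m\<in>L. \<Sum>X\<in>Pow I. 2 powr Y X m)"
    by simp (rule sum.swap)
  also have "\<dots> \<le> (\<Sum>m\<in>L. 3 ^ card I)"
    unfolding Y_def by (intro sum_mono sum_two_powr_index_le I)
  finally show ?thesis by (simp add: a_def)
qed

lemma finite_card_bool_lists: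
  "finite {m :: bool list. length m \<le> s}" "card {m :: bool list. length m \<le> s} \<le> 2 ^ (s + 1)"
proof -
  have eq: "{m :: bool list. length m \<le> s} = {m. set m \<subseteq> UNIV \<and> length m \<le> s}" by simp
  show "finite {m :: bool list. length m \<le> s}"
    unfolding eq by (rule finite_lists_length_le) simp
  have "card {m :: bool list. length m \<le> s} = (\<Sum>i\<le>s. 2 ^ i)"
    unfolding eq by (subst card_lists_length_le) (simp_all add: card_UNIV_bool)
  also have "\<dots> \<le> 2 ^ (s + 1)"
    by (induction s) auto
  finally show "card {m :: bool list. length m \<le> s} \<le> 2 ^ (s + 1)" .
qed

lemma space_lower_bound:
  fixes A :: "'r streaming_alg"
  assumes dec: "decides_opt_pos n A" and space: "space_used n A = enat s"
  shows "(2::real) ^ n * 2 powr (2 / 3 * n) \<le> 2 ^ (s + 1) * 3 ^ n"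
proof -
  define I where "I = {1..n}"
  define L where "L = {m :: bool list. length m \<le> s}"
  \<comment> \<open>The memory after the first clause is the message. The decoder processes the
    second clause and answers, with its own fresh coins; both sides share the seed
    \<open>r\<close>.\<close>
  define M where "M r X = memory_after A r [Pos ` X]" for r and X :: "nat set"
  define g where "g r i m = bind_pmf (update A r {Neg i} m) (answer A r)" for r i m
  define S where "S r = (\<Sum>X\<in>Pow I. \<Sum>i\<in>I. pmf (bind_pmf (M r X) (g r i)) (i \<in> X))" for r
  have I: "finite I" "card I = n" by (simp_all add: I_def)
  have result: "result A [Pos ` X, {Neg i}] = bind_pmf (seed A) (\<lambda>r. bind_pmf (M r X) (g r i))"
    for X i
    by (simp add: result_def memory_after_def M_def g_def[abs_def] bind_assoc_pmf)
  have succ: "2 / 3 \<le> measure_pmf.expectation (seed A) (\<lambda>r. pmf (bind_pmf (M r X) (g r i)) (i \<in> X))"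
    if "X \<in> Pow I" "i \<in> I" for X i
  proof -
    have "[Pos ` X, {Neg i}] \<in> lists (clauses n)"
      using that by (auto simp: clauses_def I_def)
    then have "2 / 3 \<le> measure_pmf.prob (result A [Pos ` X, {Neg i}])
        {b. b \<longleftrightarrow> min_sat_opt [Pos ` X, {Neg i}] > 0}"
      using dec unfolding decides_opt_pos_def by blast
    also have "\<dots> = pmf (result A [Pos ` X, {Neg i}]) (i \<in> X)"
      by (simp only: min_sat_opt_index) (simp add: measure_pmf_single)
    finally show ?thesis
      by (simp add: result pmf_bind)
  qed
  have int: "integrable (measure_pmf (seed A)) (\<lambda>r. pmf (bind_pmf (M r X) (g r i)) b)" for X i b
    by (rule measure_pmf.integrable_const_bound[where B = 1]) (auto simp: pmf_le_1)
  have "2 / 3 * n * 2 ^ n = (\<Sum>X\<in>Pow I. \<Sum>i\<in>I. 2 / 3 :: real)"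
    using I by (simp add: card_Pow)
  also have "\<dots> \<le> (\<Sum>X\<in>Pow I. \<Sum>i\<in>I.
      measure_pmf.expectation (seed A) (\<lambda>r. pmf (bind_pmf (M r X) (g r i)) (i \<in> X)))"
    by (intro sum_mono succ)
  also have "\<dots> = measure_pmf.expectation (seed A) S"
    unfolding S_def[abs_def] using int by (simp add: Bochner_Integration.integral_sum)
  \<comment> \<open>The score is summed over all \<open>X\<close> and \<open>i\<close> before
    averaging, so a single seed serves all pairs together.\<close>
  finally have "\<exists>r\<in>set_pmf (seed A). 2 / 3 * n * 2 ^ n \<le> S r"
    by (intro ex_set_pmf_expectation_le) (auto simp: S_def[abs_def] int)
  then obtain r where r: "r \<in> set_pmf (seed A)" "2 / 3 * n * 2 ^ n \<le> S r" by blast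
  have "set_pmf (M r X) \<subseteq> L" if "X \<subseteq> I" for X
  proof
    fix m assume m: "m \<in> set_pmf (M r X)"
    have "[Pos ` X] \<in> lists (clauses n)"
      using that by (auto simp: clauses_def I_def)
    then have "enat (length m) \<le> space_used n A"
      unfolding space_used_def using r(1) m unfolding M_def by (meson SUP_upper2 order_refl)
    then show "m \<in> L" by (simp add: space L_def)
  qed
  then have "2 ^ card I * 2 powr (2 / 3 * card I) \<le> card L * (3::real) ^ card I"
    using r(2) I finite_card_bool_lists(1)
    by (intro index_lower_bound[where M = "M r" and g = "g r"]) (auto simp: L_def S_def)
  also have "\<dots> \<le> 2 ^ (s + 1) * 3 ^ card I"
  proof (rule mult_right_mono)
    show "real (card L) \<le> 2 ^ (s + 1)"
      unfolding L_def using finite_card_bool_lists(2)[of s]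
      by (metis numeral_power_eq_of_nat_cancel_iff of_nat_le_iff)
  qed simp
  finally show ?thesis by (simp add: I)
qed

theorem theorem6:
  "\<exists>c::real. c > 0 \<and>
     (\<exists>N. \<forall>n\<ge>N. \<forall>A :: 'r streaming_alg.
        decides_opt_pos n A \<longrightarrow> ereal (c * real n) \<le> ereal_of_enat (space_used n A))"
proof -
  \<comment> \<open>Taking logarithms in \<open>space_lower_bound\<close> leaves this coefficient of
    \<open>n\<close>. It is positive because 27 < 32.\<close>
  define \<delta> :: real where "\<delta> = 5 / 3 - log 2 3"
  have "3 * log 2 3 = log 2 (3 ^ 3)" using log_nat_power[of 3 2 3] by simp
  also have "\<dots> < log 2 (2 ^ 5)" by (subst log_less_cancel_iff) auto
  also have "\<dots> = 5" by (subst log_nat_power) auto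
  finally have \<delta>: "\<delta> > 0" by (simp add: \<delta>_def)
  have "ereal (\<delta> / 2 * real n) \<le> ereal_of_enat (space_used n A)"
    if n: "n \<ge> nat \<lceil>2 / \<delta>\<rceil>" and dec: "decides_opt_pos n A" for n and A :: "'r streaming_alg"
  proof (cases "space_used n A")
    case (enat s)
    have "2 powr (5 / 3 * n) = 2 ^ n * 2 powr (2 / 3 * real n)"
      by (simp flip: powr_realpow powr_add)
    also have "\<dots> \<le> 2 ^ (s + 1) * 3 ^ n"
      using space_lower_bound[OF dec enat] .
    also have "\<dots> = 2 powr (real s + 1 + log 2 3 * n)"
      by (simp add: powr_add powr_realpow flip: powr_powr)
    finally have "5 / 3 * n \<le> real s + 1 + log 2 3 * n"
      by simp
    then have "\<delta> * n \<le> real s + 1"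
      by (simp add: \<delta>_def algebra_simps)
    \<comment> \<open>Half of \<open>\<delta> * n\<close> absorbs the additive 1 that comes from
      counting memory contents of all lengths up to \<open>s\<close>.\<close>
    moreover have "2 / \<delta> \<le> n" using n by linarith
    then have "1 \<le> \<delta> / 2 * n" using \<delta> by (simp add: field_simps)
    ultimately show ?thesis by (simp add: enat)
  qed simp
  with \<delta> show ?thesis
    by (intro exI[of _ "\<delta> / 2"] conjI exI[of _ "nat \<lceil>2 / \<delta>\<rceil>"]) auto
qed

end
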